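(* Let $\mathsf{V}$ be a discriminator variety of finite similarity type that is generated, as a variety, by its finite members. Let $X$ be a finite set and let $\mathfrak{F}$ be the $\mathsf{V}$-free algebra freely generated by $X$. Let $\le$ be a binary relation on the universe of $\mathfrak{F}$ that is a pre-order and is definable in $\mathfrak{F}$. Then $\le$ is atomic, i.e., for all $a,b\in \mathfrak{F}$ with $a<b$ there is $c\in\mathfrak{F}$ such that $a<c\le b$ and there is no $x\in\mathfrak{F}$ with $a<x<c$.
   Context: A similarity type is finite if it has finitely many operation symbols (constants included), each of finite arity. A variety $\mathsf{V}$ is generated by its finite members as a variety if $\mathsf{V}$ is the smallest variety containing all finite algebras in $\mathsf{V}$ (equivalently, every equation valid in all finite members of $\mathsf{V}$ is valid in $\mathsf{V}$). A variety $\mathsf{V}$ is a discriminator variety if there is a term $\sigma(x,y,u,v)$ in its language that is a switching term in each subdirectly irreducible member of $\mathsf{V}$, i.e., for all elements $x,y,u,v$ of such a member, $\sigma(x,y,u,v)=u$ if $x=y$, and $\sigma(x,y,u,v)=v$ if $x\ne y$. A pre-order $\le$ is a reflexive and transitive relation (antisymmetry is not assumed); $a<b$ abbreviates that $a\le b$ and $b\not\le a$. A pre-order $\le$ is called atomic if $\forall a<b\ \exists c\,[a<c\le b\ \wedge\ \neg\exists x\,(a<x<c)]$. A binary relation $\le$ in an algebra $\mathfrak{F}$ is definable if it is equationally definable, i.e., there are terms $\tau(x,y),\sigma'(x,y)$ in the language of $\mathfrak{F}$ such that $\mathfrak{F}\models\forall x\,\forall y\,[x\le y\leftrightarrow \tau(x,y)=\sigma'(x,y)]$.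 *)

theory Defs
  imports Main
begin

(* A similarity type is a set of operation symbols together with their arities; constants are the
   symbols of arity 0.  The set may be empty, which is why it is not simply a type. *)

record 'f sim_type =
  symbols :: "'f set"
  arity :: "'f \<Rightarrow> nat"

definition finite_sim_type :: "'f sim_type \<Rightarrow> bool" where
  "finite_sim_type S \<longleftrightarrow> finite (symbols S)"

datatype 'f trm = Var nat | Op 'f "'f trm list"

fun wf_trm :: "'f sim_type \<Rightarrow> 'f trm \<Rightarrow> bool" where
  "wf_trm S (Var i) \<longleftrightarrow> True"
| "wf_trm S (Op f ts) \<longleftrightarrow>
     f \<in> symbols S \<and> length ts = arity S f \<and> (\<forall>t\<in>set ts. wf_trm S t)"

fun trm_vars :: "'f trm \<Rightarrow> nat set" where
  "trm_vars (Var i) = {i}"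
| "trm_vars (Op f ts) = (\<Union>t\<in>set ts. trm_vars t)"

definition terms_in :: "'f sim_type \<Rightarrow> nat \<Rightarrow> 'f trm set" where
  "terms_in S n = {t. wf_trm S t \<and> trm_vars t \<subseteq> {..<n}}"

(* Classes of algebras are sets of algebras whose universes are subsets of one type 'u.  For an
   infinite 'u this loses nothing: the similarity types of interest are finite, and the conditions
   imposed below on a variety hold for all algebras as soon as they hold for the countable ones.
   For a finite 'u every pre-order on a universe is atomic, so nothing unwanted is asserted there. *)

record ('f, 'u) algebra =
  univ :: "'u set"
  oper :: "'f \<Rightarrow> 'u list \<Rightarrow> 'u"

definition is_algebra :: "'f sim_type \<Rightarrow> ('f, 'u) algebra \<Rightarrow> bool" where
  "is_algebra S A \<longleftrightarrow> univ A \<noteq> {} \<and>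
     (\<forall>f\<in>symbols S. \<forall>xs. length xs = arity S f \<and> set xs \<subseteq> univ A \<longrightarrow> oper A f xs \<in> univ A)"

fun eval :: "('f, 'u) algebra \<Rightarrow> (nat \<Rightarrow> 'u) \<Rightarrow> 'f trm \<Rightarrow> 'u" where
  "eval A e (Var i) = e i"
| "eval A e (Op f ts) = oper A f (map (eval A e) ts)"

(* Only meant for terms in terms_in S (length xs). *)
definition term_fun :: "('f, 'u) algebra \<Rightarrow> 'f trm \<Rightarrow> 'u list \<Rightarrow> 'u" where
  "term_fun A t xs = eval A (\<lambda>i. xs ! i) t"

definition satisfies :: "('f, 'u) algebra \<Rightarrow> 'f trm \<times> 'f trm \<Rightarrow> bool" where
  "satisfies A eq \<longleftrightarrow>
     (\<forall>e. range e \<subseteq> univ A \<longrightarrow> eval A e (fst eq) = eval A e (snd eq))"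

definition models :: "'f sim_type \<Rightarrow> ('f trm \<times> 'f trm) set \<Rightarrow> ('f, 'u) algebra set" where
  "models S E = {A. is_algebra S A \<and> (\<forall>eq\<in>E. satisfies A eq)}"

definition variety :: "'f sim_type \<Rightarrow> ('f, 'u) algebra set \<Rightarrow> bool" where
  "variety S V \<longleftrightarrow>
     (\<exists>E. (\<forall>(s, t)\<in>E. wf_trm S s \<and> wf_trm S t) \<and> V = models S E)"

definition variety_generated_by ::
    "'f sim_type \<Rightarrow> ('f, 'u) algebra set \<Rightarrow> ('f, 'u) algebra set" where
  "variety_generated_by S K = \<Inter>{W. variety S W \<and> K \<subseteq> W}"

definition generated_by_finite_members :: "'f sim_type \<Rightarrow> ('f, 'u) algebra set \<Rightarrow> bool" where
  "generated_by_finite_members S V \<longleftrightarrow> variety_generated_by S {A\<in>V. finite (univ A)} = V"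

definition is_hom ::
    "'f sim_type \<Rightarrow> ('f, 'u) algebra \<Rightarrow> ('f, 'u) algebra \<Rightarrow> ('u \<Rightarrow> 'u) \<Rightarrow> bool" where
  "is_hom S A B h \<longleftrightarrow> h ` univ A \<subseteq> univ B \<and>
     (\<forall>f\<in>symbols S. \<forall>xs. length xs = arity S f \<and> set xs \<subseteq> univ A \<longrightarrow>
        h (oper A f xs) = oper B f (map h xs))"

(* A subdirect embedding of A into a product, given by its coordinate maps: each (B, h) in H is a
   factor B with the map h from A onto B, and the induced map of A into the product of the B is
   injective iff the maps h separate points.  Factors, being images of A, fit into the type 'u. *)
definition subdirect_embedding ::
    "'f sim_type \<Rightarrow> ('f, 'u) algebra \<Rightarrow> (('f, 'u) algebra \<times> ('u \<Rightarrow> 'u)) set \<Rightarrow> bool" where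
  "subdirect_embedding S A H \<longleftrightarrow>
     (\<forall>(B, h)\<in>H. is_algebra S B \<and> is_hom S A B h \<and> h ` univ A = univ B) \<and>
     (\<forall>x\<in>univ A. \<forall>y\<in>univ A. x \<noteq> y \<longrightarrow> (\<exists>(B, h)\<in>H. h x \<noteq> h y))"

(* Some coordinate map of every subdirect embedding is an isomorphism.  One-element algebras
   count as subdirectly irreducible. *)
definition subdirectly_irreducible :: "'f sim_type \<Rightarrow> ('f, 'u) algebra \<Rightarrow> bool" where
  "subdirectly_irreducible S A \<longleftrightarrow> is_algebra S A \<and>
     (\<forall>H. H \<noteq> {} \<and> subdirect_embedding S A H \<longrightarrow> (\<exists>(B, h)\<in>H. bij_betw h (univ A) (univ B)))"

definition switching_term :: "('f, 'u) algebra \<Rightarrow> 'f trm \<Rightarrow> bool" where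
  "switching_term A s \<longleftrightarrow>
     (\<forall>x\<in>univ A. \<forall>y\<in>univ A. \<forall>u\<in>univ A. \<forall>v\<in>univ A.
        term_fun A s [x, y, u, v] = (if x = y then u else v))"

definition discriminator_variety :: "'f sim_type \<Rightarrow> ('f, 'u) algebra set \<Rightarrow> bool" where
  "discriminator_variety S V \<longleftrightarrow> variety S V \<and>
     (\<exists>s\<in>terms_in S 4. \<forall>A\<in>V. subdirectly_irreducible S A \<longrightarrow> switching_term A s)"

inductive_set subalgebra_generated :: "'f sim_type \<Rightarrow> ('f, 'u) algebra \<Rightarrow> 'u set \<Rightarrow> 'u set"
  for S :: "'f sim_type" and A :: "('f, 'u) algebra" and X :: "'u set" where
  generator: "x \<in> X \<Longrightarrow> x \<in> subalgebra_generated S A X"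
| operation: "f \<in> symbols S \<Longrightarrow> length xs = arity S f \<Longrightarrow>
    (\<And>x. x \<in> set xs \<Longrightarrow> x \<in> subalgebra_generated S A X) \<Longrightarrow>
    oper A f xs \<in> subalgebra_generated S A X"

definition freely_generated_in ::
    "'f sim_type \<Rightarrow> ('f, 'u) algebra set \<Rightarrow> ('f, 'u) algebra \<Rightarrow> 'u set \<Rightarrow> bool" where
  "freely_generated_in S V F X \<longleftrightarrow>
     F \<in> V \<and> X \<subseteq> univ F \<and> subalgebra_generated S F X = univ F \<and>
     (\<forall>A\<in>V. \<forall>g. g ` X \<subseteq> univ A \<longrightarrow> (\<exists>h. is_hom S F A h \<and> (\<forall>x\<in>X. h x = g x)))"

definition definable_rel :: "'f sim_type \<Rightarrow> ('f, 'u) algebra \<Rightarrow> 'u rel \<Rightarrow> bool" where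
  "definable_rel S A r \<longleftrightarrow>
     (\<exists>s\<in>terms_in S 2. \<exists>t\<in>terms_in S 2. \<forall>x\<in>univ A. \<forall>y\<in>univ A.
        (x, y) \<in> r \<longleftrightarrow> term_fun A s [x, y] = term_fun A t [x, y])"

definition strictly_below :: "'a rel \<Rightarrow> 'a \<Rightarrow> 'a \<Rightarrow> bool" where
  "strictly_below r a b \<longleftrightarrow> (a, b) \<in> r \<and> (b, a) \<notin> r"

definition atomic_preorder_on :: "'a set \<Rightarrow> 'a rel \<Rightarrow> bool" where
  "atomic_preorder_on U r \<longleftrightarrow>
     (\<forall>a\<in>U. \<forall>b\<in>U. strictly_below r a b \<longrightarrow>
        (\<exists>c\<in>U. strictly_below r a c \<and> (c, b) \<in> r \<and>
           \<not> (\<exists>x\<in>U. strictly_below r a x \<and> strictly_below r x c)))"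

end

theory Submission
  imports Defs
begin

text \<open>Why the theorem holds. An equation that fails in the variety fails in a finite member, hence
  in a finite subdirectly irreducible one. So the free algebra \<open>F\<close> is separated by its homomorphisms
  into finite algebras on which the switching term \<open>\<sigma>\<close> works; these serve as coordinates
  (\<open>free_separated_by_finite_subdirectly_irreducibles\<close>). The pre-order, being given by an
  equation, is computed coordinatewise.

  Let \<open>a < b\<close>. Then \<open>b \<le> a\<close> fails in some coordinate \<open>h\<close>, whose image is finite. Because the
  generators and the operation symbols are finite in number, \<open>ker h\<close> is generated by finitely many
  pairs (\<open>kernel_of_finite_image_finitely_generated\<close>), and "if these pairs are identified
  then \<open>u\<close> else \<open>v\<close>" is expressed by nesting \<open>\<sigma>\<close>
  (\<open>switch_on_finitely_many_equations\<close>). The coordinates in which the pairs are identified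
  are exactly those that factor through \<open>h\<close>. Thus \<open>F\<close> behaves like a product of the finite image
  of \<open>h\<close> with another factor, and \<open>r\<close> like a product relation.

  In such a product it suffices to move in the finite factor: keep the second component of \<open>a\<close> and
  choose the first one minimal among those strictly above that of \<open>a\<close> and below that of \<open>b\<close>.
  Instead of decomposing \<open>F\<close>, \<open>atomic_preorder_if_spliceable\<close> carries out this choice with
  spliced elements only.\<close>

section \<open>Terms and homomorphisms\<close>

lemma eval_cong: "(\<And>i. i \<in> trm_vars t \<Longrightarrow> e i = e' i) \<Longrightarrow> eval A e t = eval A e' t"
proof (induction t)
  case (Op f ts)
  have "map (eval A e) ts = map (eval A e') ts"
    using Op by auto
  then show ?case
    by (metis eval.simps(2))
qed simp

lemma oper_closed:
  "is_algebra S A \<Longrightarrow> f \<in> symbols S \<Longrightarrow> length xs = arity S f \<Longrightarrow> set xs \<subseteq> univ A \<Longrightarrow>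
    oper A f xs \<in> univ A"
  by (auto simp: is_algebra_def)

lemma hom_closed: "is_hom S A B h \<Longrightarrow> x \<in> univ A \<Longrightarrow> h x \<in> univ B"
  by (auto simp: is_hom_def)

lemma hom_oper:
  "is_hom S A B h \<Longrightarrow> f \<in> symbols S \<Longrightarrow> length xs = arity S f \<Longrightarrow> set xs \<subseteq> univ A \<Longrightarrow>
    h (oper A f xs) = oper B f (map h xs)"
  by (auto simp: is_hom_def)

lemma hom_id: "is_hom S A A id"
  by (auto simp: is_hom_def)

lemma hom_comp:
  assumes "is_hom S A B h" and "is_hom S B C k"
  shows "is_hom S A C (k \<circ> h)"
  unfolding is_hom_def
proof (intro conjI ballI allI impI)
  show "(k \<circ> h) ` univ A \<subseteq> univ C"
    using hom_closed[OF assms(1)] hom_closed[OF assms(2)] by auto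
next
  fix f xs
  assume f: "f \<in> symbols S" and xs: "length xs = arity S f \<and> set xs \<subseteq> univ A"
  have "set (map h xs) \<subseteq> univ B"
    using xs hom_closed[OF assms(1)] by auto
  then show "(k \<circ> h) (oper A f xs) = oper C f (map (k \<circ> h) xs)"
    using hom_oper[OF assms(1) f] hom_oper[OF assms(2) f, of "map h xs"] xs by simp
qed

lemma eval_closed:
  assumes "is_algebra S A" and "wf_trm S t" and "\<And>i. i \<in> trm_vars t \<Longrightarrow> e i \<in> univ A"
  shows "eval A e t \<in> univ A"
  using assms(2,3)
proof (induction t)
  case (Op f ts)
  have "set (map (eval A e) ts) \<subseteq> univ A"
    using Op by auto
  then show ?case
    using Op.prems(1) oper_closed[OF assms(1), of f "map (eval A e) ts"] by simp
qed simp

lemma hom_eval: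
  assumes "is_algebra S A" and "is_hom S A B h"
    and "wf_trm S t" and "\<And>i. i \<in> trm_vars t \<Longrightarrow> e i \<in> univ A"
  shows "h (eval A e t) = eval B (h \<circ> e) t"
  using assms(3,4)
proof (induction t)
  case (Op f ts)
  have "set (map (eval A e) ts) \<subseteq> univ A"
    using Op.prems by (auto intro!: eval_closed[OF assms(1)])
  then have "h (eval A e (Op f ts)) = oper B f (map h (map (eval A e) ts))"
    using Op.prems(1) hom_oper[OF assms(2), of f "map (eval A e) ts"] by simp
  also have "map h (map (eval A e) ts) = map (eval B (h \<circ> e)) ts"
    using Op by (auto simp: comp_def)
  finally show ?case
    by (simp add: comp_def)
qed simp

lemma term_fun_closed:
  assumes "is_algebra S A" and "t \<in> terms_in S (length xs)" and "set xs \<subseteq> univ A"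
  shows "term_fun A t xs \<in> univ A"
  using assms unfolding term_fun_def terms_in_def
  by (intro eval_closed) (auto simp: subset_iff)

lemma hom_term_fun:
  assumes "is_algebra S A" and "is_hom S A B h"
    and "t \<in> terms_in S (length xs)" and "set xs \<subseteq> univ A"
  shows "h (term_fun A t xs) = term_fun B t (map h xs)"
proof -
  have "h (term_fun A t xs) = eval B (h \<circ> (\<lambda>i. xs ! i)) t"
    using assms unfolding term_fun_def terms_in_def by (intro hom_eval) (auto simp: subset_iff)
  also have "\<dots> = term_fun B t (map h xs)"
    using assms(3) unfolding term_fun_def terms_in_def by (intro eval_cong) auto
  finally show ?thesis .
qed

section \<open>Separation by finite subdirectly irreducible algebras\<close>

lemma variety_is_algebra: "variety S V \<Longrightarrow> A \<in> V \<Longrightarrow> is_algebra S A"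
  by (auto simp: variety_def models_def)

lemma variety_closed_under_images:
  assumes "variety S V" and "A \<in> V" and "is_algebra S B" and "is_hom S A B h"
    and "h ` univ A = univ B"
  shows "B \<in> V"
proof -
  obtain E where wf: "\<forall>(s, t)\<in>E. wf_trm S s \<and> wf_trm S t" and V: "V = models S E"
    using assms(1) by (auto simp: variety_def)
  have A: "is_algebra S A"
    using assms(1,2) by (rule variety_is_algebra)
  have "eval B e s = eval B e t" if st: "(s, t) \<in> E" and e: "range e \<subseteq> univ B" for s t e
  proof -
    define e' where "e' = inv_into (univ A) h \<circ> e"
    have he': "h \<circ> e' = e" and e': "range e' \<subseteq> univ A"
      using e assms(5) by (auto simp: e'_def fun_eq_iff f_inv_into_f inv_into_into subset_iff)
    have "eval A e' s = eval A e' t"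
      using st e' assms(2) by (auto simp: V models_def satisfies_def)
    moreover have "h (eval A e' s) = eval B e s" "h (eval A e' t) = eval B e t"
      using hom_eval[OF A assms(4), of _ e'] wf st e' he' by (auto simp: subset_iff)
    ultimately show ?thesis
      by simp
  qed
  then show ?thesis
    using assms(3) by (auto simp: V models_def satisfies_def)
qed

text \<open>The finite case of Birkhoff's subdirect representation theorem needs no maximal congruences:
  a finite algebra that is not subdirectly irreducible has a subdirect embedding whose factors are
  all strictly smaller, so one can descend along a factor that still separates the two points.\<close>

lemma finite_separated_by_subdirectly_irreducibles:
  assumes "variety S V" and "A \<in> V" and "finite (univ A)"
    and "x \<in> univ A" and "y \<in> univ A" and "x \<noteq> y"
  shows "\<exists>B\<in>V. \<exists>h. finite (univ B) \<and> subdirectly_irreducible S B \<and> is_hom S A B h \<and> h x \<noteq> h y"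
  using assms(2-)
proof (induction "card (univ A)" arbitrary: A x y rule: less_induct)
  case less
  show ?case
  proof (cases "subdirectly_irreducible S A")
    case True
    then show ?thesis
      using less.prems hom_id by (intro bexI[of _ A] exI[of _ id]) auto
  next
    case False
    then obtain H where sub: "subdirect_embedding S A H"
      and nbij: "\<not> (\<exists>(B, h)\<in>H. bij_betw h (univ A) (univ B))"
      using variety_is_algebra[OF assms(1) less.prems(1)]
      unfolding subdirectly_irreducible_def by blast
    have "\<exists>(B, h)\<in>H. h x \<noteq> h y"
      using sub less.prems(3-5) unfolding subdirect_embedding_def by blast
    then obtain B h where Bh: "(B, h) \<in> H" "h x \<noteq> h y"
      by blast
    then have B: "is_algebra S B" "is_hom S A B h" "h ` univ A = univ B"
      using sub unfolding subdirect_embedding_def by blast+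
    have "B \<in> V"
      using assms(1) less.prems(1) B by (rule variety_closed_under_images)
    have "\<not> inj_on h (univ A)"
      using nbij Bh(1) B(3) by (auto simp: bij_betw_def)
    then have "card (univ B) < card (univ A)"
      using B(3) less.prems(2) card_image_le[of "univ A" h] eq_card_imp_inj_on[of "univ A" h]
      by fastforce
    moreover have "finite (univ B)"
      using finite_imageI[OF less.prems(2), of h] B(3) by simp
    moreover have "h x \<in> univ B" "h y \<in> univ B"
      using hom_closed[OF B(2)] less.prems(3,4) by auto
    ultimately obtain C k where C: "C \<in> V" "finite (univ C)" "subdirectly_irreducible S C"
      and k: "is_hom S B C k" "k (h x) \<noteq> k (h y)"
      using less.hyps[of B "h x" "h y"] \<open>B \<in> V\<close> Bh(2) by blast
    have "is_hom S A C (k \<circ> h)"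
      using B(2) k(1) by (rule hom_comp)
    then show ?thesis
      using C k(2) by (intro bexI[of _ C] exI[of _ "k \<circ> h"]) auto
  qed
qed

text \<open>The models of a single equation form a variety, so an equation cannot hold in the generating
  class without holding in the generated variety.\<close>

lemma equation_valid_if_valid_in_finite_members:
  assumes "variety S V" and "generated_by_finite_members S V"
    and "wf_trm S s" and "wf_trm S t"
    and "\<And>A. A \<in> V \<Longrightarrow> finite (univ A) \<Longrightarrow> satisfies A (s, t)"
    and "A \<in> V"
  shows "satisfies A (s, t)"
proof -
  let ?W = "models S {(s, t)} :: ('a, 'b) algebra set"
  have "variety S ?W"
    using assms(3,4) unfolding variety_def by (intro exI[of _ "{(s, t)}"]) simp
  moreover have "{A \<in> V. finite (univ A)} \<subseteq> ?W"
    using assms(5) variety_is_algebra[OF assms(1)] by (simp add: models_def subset_iff)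
  ultimately have "V \<subseteq> ?W"
    using assms(2) unfolding generated_by_finite_members_def variety_generated_by_def by blast
  then show ?thesis
    using assms(6) by (auto simp: models_def)
qed

lemma generated_element_is_term_value:
  assumes "x \<in> subalgebra_generated S A (e ` {..<n})"
  shows "\<exists>t\<in>terms_in S n. x = eval A e t"
  using assms
proof induction
  case (generator x)
  then obtain i where "i < n" "x = e i"
    by auto
  then show ?case
    by (intro bexI[of _ "Var i"]) (auto simp: terms_in_def)
next
  case (operation f xs)
  then obtain T where T: "\<And>x. x \<in> set xs \<Longrightarrow> T x \<in> terms_in S n \<and> x = eval A e (T x)"
    by metis
  have "map (eval A e) (map T xs) = xs"
    using T by (simp add: map_idI)
  then have "oper A f xs = eval A e (Op f (map T xs))"
    by simp
  moreover have "Op f (map T xs) \<in> terms_in S n"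
    using T operation.hyps(1,2) by (auto simp: terms_in_def)
  ultimately show ?case
    by blast
qed

text \<open>Two elements of a free algebra are values of two terms at the free generators. If they are
  distinct, the corresponding equation fails in the variety, hence in a finite member, and the
  failing assignment extends to a homomorphism. Subdirect decomposition of the finite member then
  makes the target subdirectly irreducible.\<close>

lemma free_separated_by_finite_subdirectly_irreducibles:
  assumes "variety S V" and "generated_by_finite_members S V" and "finite X"
    and "freely_generated_in S V F X"
    and "x \<in> univ F" and "y \<in> univ F" and "x \<noteq> y"
  shows "\<exists>B\<in>V. \<exists>h. finite (univ B) \<and> subdirectly_irreducible S B \<and> is_hom S F B h \<and> h x \<noteq> h y"
proof -
  have F: "F \<in> V" "X \<subseteq> univ F" "subalgebra_generated S F X = univ F"
    and free: "\<And>A g. A \<in> V \<Longrightarrow> g ` X \<subseteq> univ A \<Longrightarrow> \<exists>h. is_hom S F A h \<and> (\<forall>x\<in>X. h x = g x)"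
    using assms(4) by (auto simp: freely_generated_in_def)
  have algF: "is_algebra S F"
    using assms(1) F(1) by (rule variety_is_algebra)
  obtain e0 :: "nat \<Rightarrow> 'b" and n where e0: "bij_betw e0 {..<n} X"
    using ex_bij_betw_nat_finite[OF assms(3)] unfolding atLeast0LessThan by blast
  \<comment> \<open>An assignment is total, so the variables beyond the generators need a dummy value.\<close>
  define e where "e i = (if i < n then e0 i else x)" for i
  have eX: "e ` {..<n} = X" and inj: "inj_on e {..<n}"
    using e0 by (auto simp: e_def bij_betw_def inj_on_def)
  have eF: "range e \<subseteq> univ F"
    using F(2) e0 assms(5) by (auto simp: e_def bij_betw_def)
  obtain s where s: "s \<in> terms_in S n" "x = eval F e s"
    using generated_element_is_term_value[of x S F e n] assms(5) F(3) eX by auto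
  obtain t where t: "t \<in> terms_in S n" "y = eval F e t"
    using generated_element_is_term_value[of y S F e n] assms(6) F(3) eX by auto
  have "\<not> satisfies F (s, t)"
    using assms(7) s(2) t(2) eF by (auto simp: satisfies_def)
  then obtain A where A: "A \<in> V" "finite (univ A)" "\<not> satisfies A (s, t)"
    using equation_valid_if_valid_in_finite_members[OF assms(1,2), of s t F] s(1) t(1) F(1)
    by (auto simp: terms_in_def)
  then obtain d where d: "range d \<subseteq> univ A" "eval A d s \<noteq> eval A d t"
    by (auto simp: satisfies_def)
  obtain h where h: "is_hom S F A h" "\<forall>x\<in>X. h x = d (inv_into {..<n} e x)"
    using free[OF A(1), of "d \<circ> inv_into {..<n} e"] d(1) by auto
  have he: "(h \<circ> e) i = d i" if "i < n" for i
    using that h(2) eX inv_into_f_f[OF inj, of i] by auto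
  have "h (eval F e u) = eval A d u" if u: "u \<in> terms_in S n" for u
  proof -
    have "h (eval F e u) = eval A (h \<circ> e) u"
      using u eF by (intro hom_eval[OF algF h(1)]) (auto simp: terms_in_def)
    also have "\<dots> = eval A d u"
      using u he by (intro eval_cong) (auto simp: terms_in_def)
    finally show ?thesis .
  qed
  then have "h x \<noteq> h y"
    using s t d(2) by simp
  moreover have "h x \<in> univ A" "h y \<in> univ A"
    using hom_closed[OF h(1)] assms(5,6) by auto
  ultimately obtain B k where B: "B \<in> V" "finite (univ B)" "subdirectly_irreducible S B"
    and k: "is_hom S A B k" "k (h x) \<noteq> k (h y)"
    using finite_separated_by_subdirectly_irreducibles[OF assms(1) A(1,2)] by blast
  have "is_hom S F B (k \<circ> h)"
    using h(1) k(1) by (rule hom_comp)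
  then show ?thesis
    using B k(2) by (intro bexI[of _ B] exI[of _ "k \<circ> h"]) auto
qed

section \<open>Splicing elements along a finite quotient\<close>

text \<open>The kernel of a homomorphism onto a finite algebra is a finitely generated congruence, when
  there are finitely many generators and operation symbols: choose a preimage of each value; it is
  enough to equate every generator, and every operation applied to chosen preimages, with the
  preimage chosen for its value.\<close>

lemma kernel_of_finite_image_finitely_generated:
  assumes "finite_sim_type S" and "finite X" and "is_algebra S A"
    and "X \<subseteq> univ A" and "subalgebra_generated S A X = univ A"
    and "is_hom S A M h" and "finite (h ` univ A)"
  shows "\<exists>P. finite P \<and> P \<subseteq> univ A \<times> univ A \<and> (\<forall>(p, q)\<in>P. h p = h q) \<and>
    (\<forall>N g. is_hom S A N g \<and> (\<forall>(p, q)\<in>P. g p = g q) \<longrightarrow>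
      (\<forall>x\<in>univ A. \<forall>y\<in>univ A. h x = h y \<longrightarrow> g x = g y))"
proof -
  define c where "c = inv_into (univ A) h"
  have cA: "c m \<in> univ A" and hc: "h (c m) = m" if "m \<in> h ` univ A" for m
    using that by (auto simp: c_def inv_into_into f_inv_into_f)
  define L where "L f = {ms. set ms \<subseteq> h ` univ A \<and> length ms = arity S f}" for f
  define P where "P = (\<lambda>x. (x, c (h x))) ` X \<union>
    (\<Union>f\<in>symbols S. (\<lambda>ms. (oper A f (map c ms), c (h (oper A f (map c ms))))) ` L f)"
  have cL: "oper A f (map c ms) \<in> univ A" if "f \<in> symbols S" "ms \<in> L f" for f ms
    using that cA by (intro oper_closed[OF assms(3)]) (auto simp: L_def)
  have "finite P"
    using assms(1,2,7) finite_lists_length_eq[OF assms(7)]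
    by (auto simp: P_def L_def finite_sim_type_def)
  moreover have "P \<subseteq> univ A \<times> univ A"
    using assms(4) cA cL by (auto simp: P_def)
  moreover have "\<forall>(p, q)\<in>P. h p = h q"
    using assms(4) hc cL by (auto simp: P_def)
  moreover have "g x = g y" if g: "is_hom S A N g" and gP: "\<forall>(p, q)\<in>P. g p = g q"
    and xy: "x \<in> univ A" "y \<in> univ A" "h x = h y" for N g x y
  proof -
    have "g u = g (c (h u))" if "u \<in> subalgebra_generated S A X" for u
      using that
    proof induction
      case (generator x)
      then show ?case
        using gP by (auto simp: P_def)
    next
      case (operation f xs)
      let ?ms = "map h xs"
      have xsA: "set xs \<subseteq> univ A"
        using operation.hyps(3) assms(5) by auto
      then have ms: "?ms \<in> L f"
        using operation.hyps(2) by (auto simp: L_def)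
      have cmsA: "set (map c ?ms) \<subseteq> univ A"
        using cA xsA by auto
      have "h (oper A f (map c ?ms)) = oper M f (map h (map c ?ms))"
        using hom_oper[OF assms(6) operation.hyps(1) _ cmsA] operation.hyps(2) by simp
      also have "map h (map c ?ms) = map h xs"
        using hc xsA by auto
      also have "oper M f (map h xs) = h (oper A f xs)"
        using hom_oper[OF assms(6) operation.hyps(1,2) xsA] by simp
      finally have same_value: "h (oper A f (map c ?ms)) = h (oper A f xs)" .
      have "g (oper A f xs) = oper N f (map g xs)"
        using hom_oper[OF g operation.hyps(1,2) xsA] .
      also have "map g xs = map g (map c ?ms)"
        using operation.IH by auto
      also have "oper N f \<dots> = g (oper A f (map c ?ms))"
        using hom_oper[OF g operation.hyps(1) _ cmsA] operation.hyps(2) by simp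
      also have "\<dots> = g (c (h (oper A f (map c ?ms))))"
        using gP operation.hyps(1) ms unfolding P_def by blast
      finally show ?case
        by (simp only: same_value)
    qed
    then show ?thesis
      using xy assms(5) by metis
  qed
  ultimately show ?thesis
    by (intro exI[of _ P]) blast
qed

text \<open>Nesting the switching term expresses "if p = q for all listed pairs then u else v" by an
  element of the algebra.\<close>

lemma switch_on_finitely_many_equations:
  assumes "is_algebra S A" and "\<sigma> \<in> terms_in S 4"
    and "finite P" and "P \<subseteq> univ A \<times> univ A" and "u \<in> univ A" and "v \<in> univ A"
  shows "\<exists>w\<in>univ A. \<forall>N g. is_hom S A N g \<and> switching_term N \<sigma> \<longrightarrow>
    g w = (if \<forall>(p, q)\<in>P. g p = g q then g u else g v)"
  using assms(3,4)
proof (induction P)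
  case empty
  then show ?case
    using assms(5) by auto
next
  case (insert pq P)
  obtain p q where pq: "pq = (p, q)"
    by fastforce
  obtain w where w: "w \<in> univ A" "\<And>N g. is_hom S A N g \<Longrightarrow> switching_term N \<sigma> \<Longrightarrow>
      g w = (if \<forall>(p, q)\<in>P. g p = g q then g u else g v)"
    using insert by auto
  have set: "set [p, q, w, v] \<subseteq> univ A"
    using insert.prems w(1) assms(6) pq by auto
  have \<sigma>: "\<sigma> \<in> terms_in S (length [p, q, w, v])"
    using assms(2) by (simp add: eval_nat_numeral)
  have "g (term_fun A \<sigma> [p, q, w, v]) =
      (if \<forall>(p, q)\<in>insert pq P. g p = g q then g u else g v)"
    if g: "is_hom S A N g" "switching_term N \<sigma>" for N g
  proof -
    have "g (term_fun A \<sigma> [p, q, w, v]) = term_fun N \<sigma> [g p, g q, g w, g v]"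
      using hom_term_fun[OF assms(1) g(1) \<sigma> set] by simp
    also have "\<dots> = (if g p = g q then g w else g v)"
      using g(2) set hom_closed[OF g(1)] by (auto simp: switching_term_def)
    finally show ?thesis
      using w(2)[OF g] pq by auto
  qed
  moreover have "term_fun A \<sigma> [p, q, w, v] \<in> univ A"
    using term_fun_closed[OF assms(1) \<sigma> set] .
  ultimately show ?case
    by blast
qed

section \<open>Atomicity from splicing\<close>

lemma finite_strictly_below_minimal:
  assumes "finite C" and "C \<noteq> {}" and "trans r"
  shows "\<exists>c\<in>C. \<forall>x\<in>C. \<not> strictly_below r x c"
proof -
  have "asymp_on C (strictly_below r)"
    by (simp add: asymp_on_def strictly_below_def)
  moreover have "transp_on C (strictly_below r)"
    using transD[OF assms(3)] unfolding transp_on_def strictly_below_def by meson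
  ultimately obtain c where "c \<in> C" "\<forall>x\<in>C. x \<noteq> c \<longrightarrow> \<not> strictly_below r x c"
    using Finite_Set.bex_min_element assms(1,2) by metis
  then show ?thesis
    by (auto simp: strictly_below_def)
qed

text \<open>A purely order-theoretic statement about a pre-order given by coordinates. Suppose that a
  coordinate \<open>i\<close> comes with a block \<open>D\<close> of coordinates that it determines, that any two elements
  can be spliced along \<open>D\<close>, and that \<open>i\<close> takes finitely many values. If \<open>b \<le> a\<close> fails at \<open>i\<close>,
  then the elements that agree with \<open>a\<close> outside \<open>D\<close> form a finite set, and a minimal one among
  those in \<open>]a, b]\<close> covers \<open>a\<close>: an \<open>x\<close> strictly between \<open>a\<close> and such a \<open>c\<close> may be replaced by its
  splice with \<open>a\<close>, which is still strictly between them.\<close>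

lemma atomic_preorder_if_spliceable:
  fixes \<pi> :: "'i \<Rightarrow> 'a \<Rightarrow> 'b" and R :: "'i \<Rightarrow> 'b rel"
  assumes pre: "preorder_on U r"
    and r_iff: "\<And>x y. x \<in> U \<Longrightarrow> y \<in> U \<Longrightarrow> (x, y) \<in> r \<longleftrightarrow> (\<forall>i\<in>I. (\<pi> i x, \<pi> i y) \<in> R i)"
    and sep: "\<And>x y. x \<in> U \<Longrightarrow> y \<in> U \<Longrightarrow> \<forall>i\<in>I. \<pi> i x = \<pi> i y \<Longrightarrow> x = y"
    and fin: "\<And>i. i \<in> I \<Longrightarrow> finite (\<pi> i ` U)"
    and splice: "\<And>i. i \<in> I \<Longrightarrow> \<exists>D. i \<in> D \<and> D \<subseteq> I \<and>
      (\<forall>u\<in>U. \<forall>v\<in>U. \<exists>w\<in>U. \<forall>j\<in>I. \<pi> j w = (if j \<in> D then \<pi> j u else \<pi> j v)) \<and>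
      (\<forall>j\<in>D. \<forall>x\<in>U. \<forall>y\<in>U. \<pi> i x = \<pi> i y \<longrightarrow> \<pi> j x = \<pi> j y) \<and>
      (\<forall>j\<in>D. \<forall>x\<in>U. \<forall>y\<in>U. (\<pi> i x, \<pi> i y) \<in> R i \<longrightarrow> (\<pi> j x, \<pi> j y) \<in> R j)"
  shows "atomic_preorder_on U r"
  unfolding atomic_preorder_on_def
proof (intro ballI impI)
  fix a b
  assume a: "a \<in> U" and b: "b \<in> U" and ab: "strictly_below r a b"
  have trans: "\<And>x y z. (x, y) \<in> r \<Longrightarrow> (y, z) \<in> r \<Longrightarrow> (x, z) \<in> r"
    using pre unfolding preorder_on_def by (blast dest: transD)
  have refl: "\<And>x. x \<in> U \<Longrightarrow> (x, x) \<in> r"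
    using pre by (simp add: preorder_on_def refl_on_def)
  have coord: "(\<pi> j x, \<pi> j y) \<in> R j" if "(x, y) \<in> r" "x \<in> U" "y \<in> U" "j \<in> I" for x y j
    using r_iff that by blast
  obtain i where i: "i \<in> I" "(\<pi> i b, \<pi> i a) \<notin> R i"
    using ab r_iff[OF b a] by (auto simp: strictly_below_def)
  obtain D where D: "i \<in> D" "D \<subseteq> I"
    and splices: "\<forall>u\<in>U. \<forall>v\<in>U. \<exists>w\<in>U. \<forall>j\<in>I. \<pi> j w = (if j \<in> D then \<pi> j u else \<pi> j v)"
    and determs: "\<forall>j\<in>D. \<forall>x\<in>U. \<forall>y\<in>U. \<pi> i x = \<pi> i y \<longrightarrow> \<pi> j x = \<pi> j y"
    and rels: "\<forall>j\<in>D. \<forall>x\<in>U. \<forall>y\<in>U. (\<pi> i x, \<pi> i y) \<in> R i \<longrightarrow> (\<pi> j x, \<pi> j y) \<in> R j"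
    using splice[OF i(1)] by (elim exE conjE) (rule that)
  have determ: "\<pi> j x = \<pi> j y" if "j \<in> D" "x \<in> U" "y \<in> U" "\<pi> i x = \<pi> i y" for j x y
    using determs that by blast
  have rel: "(\<pi> j x, \<pi> j y) \<in> R j"
    if "j \<in> D" "x \<in> U" "y \<in> U" "(\<pi> i x, \<pi> i y) \<in> R i" for j x y
    using rels that by blast
  define C where "C = {w \<in> U. \<forall>j\<in>I - D. \<pi> j w = \<pi> j a}"
  have "inj_on (\<pi> i) C"
  proof (rule inj_onI)
    fix x y
    assume "x \<in> C" "y \<in> C" "\<pi> i x = \<pi> i y"
    then have "\<pi> j x = \<pi> j y" if "j \<in> I" for j
      using that determ[of j x y] by (cases "j \<in> D") (auto simp: C_def)
    then show "x = y"
      using \<open>x \<in> C\<close> \<open>y \<in> C\<close> sep by (auto simp: C_def)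
  qed
  moreover have "finite (\<pi> i ` C)"
    using fin[OF i(1)] by (rule finite_subset[rotated]) (auto simp: C_def)
  ultimately have "finite C"
    by (rule finite_imageD[rotated])
  obtain W where W: "\<And>u. u \<in> U \<Longrightarrow> W u \<in> C"
    and WD: "\<And>u j. u \<in> U \<Longrightarrow> j \<in> D \<Longrightarrow> \<pi> j (W u) = \<pi> j u"
  proof -
    have "\<forall>u\<in>U. \<exists>w\<in>U. \<forall>j\<in>I. \<pi> j w = (if j \<in> D then \<pi> j u else \<pi> j a)"
      using splices a by blast
    then obtain W where "\<And>u. u \<in> U \<Longrightarrow> W u \<in> U"
        "\<And>u j. u \<in> U \<Longrightarrow> j \<in> I \<Longrightarrow> \<pi> j (W u) = (if j \<in> D then \<pi> j u else \<pi> j a)"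
      by metis
    then show thesis
      using D(2) by (intro that[of W]) (auto simp: C_def subset_iff)
  qed
  have CU: "\<And>x. x \<in> C \<Longrightarrow> x \<in> U"
    and Ca: "\<And>x j. x \<in> C \<Longrightarrow> j \<in> I \<Longrightarrow> j \<notin> D \<Longrightarrow> \<pi> j x = \<pi> j a"
    by (auto simp: C_def)
  have above: "(a, W x) \<in> r \<and> (W x, x) \<in> r" if x: "x \<in> U" and ax: "(a, x) \<in> r" for x
  proof
    have Wx: "W x \<in> U"
      using W[OF x] CU by blast
    have "(\<pi> j a, \<pi> j (W x)) \<in> R j" if "j \<in> I" for j
      using that WD[OF x] Ca[OF W[OF x]] coord[OF ax a x] coord[OF refl[OF a] a a]
      by (cases "j \<in> D") auto
    then show "(a, W x) \<in> r"
      using r_iff[OF a Wx] by blast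
    have "(\<pi> j (W x), \<pi> j x) \<in> R j" if "j \<in> I" for j
      using that WD[OF x] Ca[OF W[OF x]] coord[OF ax a x] coord[OF refl[OF x] x x]
      by (cases "j \<in> D") auto
    then show "(W x, x) \<in> r"
      using r_iff[OF Wx x] by blast
  qed
  define K where "K = {c \<in> C. strictly_below r a c \<and> (c, b) \<in> r}"
  have "W b \<in> K"
    using above[OF b] ab W[OF b] WD[OF b D(1)] i coord[OF _ CU[OF W[OF b]] a i(1)]
    by (auto simp: K_def strictly_below_def)
  moreover have "finite K"
    using \<open>finite C\<close> by (simp add: K_def)
  ultimately obtain c where c: "c \<in> K" and min: "\<And>x. x \<in> K \<Longrightarrow> \<not> strictly_below r x c"
    using finite_strictly_below_minimal[of K r] pre by (auto simp: preorder_on_def)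
  have cC: "c \<in> C" "strictly_below r a c" "(c, b) \<in> r"
    using c by (auto simp: K_def)
  have False if x: "x \<in> U" and ax: "strictly_below r a x" and xc: "strictly_below r x c" for x
  proof -
    have Wx: "(a, W x) \<in> r" "(W x, x) \<in> r"
      using above[OF x] ax by (auto simp: strictly_below_def)
    have xc': "(x, c) \<in> r"
      using xc by (simp add: strictly_below_def)
    have "(W x, a) \<notin> r"
    proof
      assume "(W x, a) \<in> r"
      then have "(\<pi> i x, \<pi> i a) \<in> R i"
        using coord[OF _ CU[OF W[OF x]] a i(1)] WD[OF x D(1)] by simp
      \<comment> \<open>Inside the block, coordinate \<open>i\<close> decides; outside, \<open>c\<close> looks like \<open>a\<close>.\<close>
      then have "(\<pi> j x, \<pi> j a) \<in> R j" if "j \<in> I" for j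
        using that rel[OF _ x a] Ca[OF cC(1) that] coord[OF xc' x CU[OF cC(1)] that]
        by (cases "j \<in> D") auto
      then have "(x, a) \<in> r"
        using r_iff[OF x a] by blast
      then show False
        using ax by (simp add: strictly_below_def)
    qed
    moreover have "strictly_below r (W x) c"
      using Wx(2) xc trans unfolding strictly_below_def by blast
    moreover have "(W x, b) \<in> r"
      using Wx(2) xc' cC(3) trans by blast
    ultimately show False
      using min[of "W x"] W[OF x] Wx(1) by (auto simp: K_def strictly_below_def)
  qed
  then show "\<exists>c\<in>U. strictly_below r a c \<and> (c, b) \<in> r \<and>
      \<not> (\<exists>x\<in>U. strictly_below r a x \<and> strictly_below r x c)"
    using cC CU by blast
qed

section \<open>Definable pre-orders on free algebras\<close>

theorem theorem1:
  fixes S :: "'f sim_type"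
    and V :: "('f, 'u) algebra set"
    and F :: "('f, 'u) algebra"
    and X :: "'u set"
    and r :: "'u rel"
  assumes "finite_sim_type S"
    and "discriminator_variety S V"
    and "generated_by_finite_members S V"
    and "finite X"
    and "freely_generated_in S V F X"
    and "preorder_on (univ F) r"
    and "definable_rel S F r"
  shows "atomic_preorder_on (univ F) r"
proof -
  obtain \<sigma> where var: "variety S V" and \<sigma>: "\<sigma> \<in> terms_in S 4"
    and switch: "\<And>A. A \<in> V \<Longrightarrow> subdirectly_irreducible S A \<Longrightarrow> switching_term A \<sigma>"
    using assms(2) by (auto simp: discriminator_variety_def)
  have FV: "F \<in> V" and XF: "X \<subseteq> univ F" and gen: "subalgebra_generated S F X = univ F"
    using assms(5) by (auto simp: freely_generated_in_def)
  have F: "is_algebra S F"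
    using var FV by (rule variety_is_algebra)
  obtain s t where s: "s \<in> terms_in S 2" and t: "t \<in> terms_in S 2"
    and def_r: "\<And>x y. x \<in> univ F \<Longrightarrow> y \<in> univ F \<Longrightarrow>
      (x, y) \<in> r \<longleftrightarrow> term_fun F s [x, y] = term_fun F t [x, y]"
    using assms(7) unfolding definable_rel_def by blast
  define I where "I = {(N, g). finite (univ N) \<and> switching_term N \<sigma> \<and> is_hom S F N g}"
  define R where "R = (\<lambda>(N :: ('f, 'u) algebra, g :: 'u \<Rightarrow> 'u).
    {(x, y). term_fun N s [x, y] = term_fun N t [x, y]})"
  have sep: "x = y" if xy: "x \<in> univ F" "y \<in> univ F" "\<forall>i\<in>I. snd i x = snd i y" for x y
  proof (rule ccontr)
    assume "x \<noteq> y"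
    then obtain B h where "B \<in> V" "finite (univ B)" "subdirectly_irreducible S B"
        "is_hom S F B h" "h x \<noteq> h y"
      using free_separated_by_finite_subdirectly_irreducibles[OF var assms(3-5) xy(1,2)] by blast
    then show False
      using xy(3) switch by (force simp: I_def)
  qed
  have closed2: "term_fun F u [x, y] \<in> univ F"
    and hom2: "is_hom S F N g \<Longrightarrow> g (term_fun F u [x, y]) = term_fun N u [g x, g y]"
    if "u \<in> terms_in S 2" "x \<in> univ F" "y \<in> univ F" for u x y N g
    using that term_fun_closed[OF F, of u "[x, y]"] hom_term_fun[OF F, of N g u "[x, y]"]
    by (auto simp: numeral_2_eq_2)
  have R_iff: "(g x, g y) \<in> R (N, g) \<longleftrightarrow> g (term_fun F s [x, y]) = g (term_fun F t [x, y])"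
    if "is_hom S F N g" "x \<in> univ F" "y \<in> univ F" for N g x y
    using that hom2 s t by (simp add: R_def)
  have finite_image: "finite (g ` univ F)" if "is_hom S F N g" "finite (univ N)" for N g
    using that finite_subset unfolding is_hom_def by blast
  show ?thesis
  proof (rule atomic_preorder_if_spliceable[where I = I and \<pi> = snd and R = R])
    fix x y
    assume xy: "x \<in> univ F" "y \<in> univ F"
    have "(x, y) \<in> r \<longleftrightarrow>
        (\<forall>i\<in>I. snd i (term_fun F s [x, y]) = snd i (term_fun F t [x, y]))"
      using def_r[OF xy] sep closed2[OF s xy] closed2[OF t xy] by metis
    also have "\<dots> \<longleftrightarrow> (\<forall>i\<in>I. (snd i x, snd i y) \<in> R i)"
      using R_iff xy by (intro ball_cong) (auto simp: I_def)
    finally show "(x, y) \<in> r \<longleftrightarrow> (\<forall>i\<in>I. (snd i x, snd i y) \<in> R i)" .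
  next
    fix i
    assume "i \<in> I"
    then show "finite (snd i ` univ F)"
      using finite_image by (auto simp: I_def)
  next
    fix i
    assume "i \<in> I"
    then obtain M h where i: "i = (M, h)" and M: "finite (univ M)" and h: "is_hom S F M h"
      by (auto simp: I_def)
    have fin: "finite (h ` univ F)"
      using h M by (rule finite_image)
    obtain P where P: "finite P" "P \<subseteq> univ F \<times> univ F" "\<forall>(p, q)\<in>P. h p = h q"
      and P_ker: "\<forall>N g. is_hom S F N g \<and> (\<forall>(p, q)\<in>P. g p = g q) \<longrightarrow>
        (\<forall>x\<in>univ F. \<forall>y\<in>univ F. h x = h y \<longrightarrow> g x = g y)"
      using kernel_of_finite_image_finitely_generated[OF assms(1,4) F XF gen h fin]
      by (elim exE conjE) (rule that)
    have ker: "g x = g y" if "is_hom S F N g" "\<forall>(p, q)\<in>P. g p = g q"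
      "x \<in> univ F" "y \<in> univ F" "h x = h y" for N g x y
      using P_ker that by blast
    \<comment> \<open>the coordinates whose kernel contains that of \<open>h\<close>\<close>
    define D where "D = {j \<in> I. \<forall>(p, q)\<in>P. snd j p = snd j q}"
    have "\<exists>w\<in>univ F. \<forall>j\<in>I. snd j w = (if j \<in> D then snd j u else snd j v)"
      if uv: "u \<in> univ F" "v \<in> univ F" for u v
    proof -
      obtain w where w: "w \<in> univ F" "\<forall>N g. is_hom S F N g \<and> switching_term N \<sigma> \<longrightarrow>
          g w = (if \<forall>(p, q)\<in>P. g p = g q then g u else g v)"
        using switch_on_finitely_many_equations[OF F \<sigma> P(1,2) uv] by (elim bexE) (rule that)
      have "snd j w = (if j \<in> D then snd j u else snd j v)" if j: "j \<in> I" for j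
      proof -
        have "is_hom S F (fst j) (snd j) \<and> switching_term (fst j) \<sigma>"
          using j by (auto simp: I_def)
        then have "snd j w = (if \<forall>(p, q)\<in>P. snd j p = snd j q then snd j u else snd j v)"
          by (rule w(2)[rule_format])
        then show ?thesis
          using j by (simp add: D_def)
      qed
      then show ?thesis
        using w(1) by blast
    qed
    moreover have "i \<in> D" "D \<subseteq> I"
      using \<open>i \<in> I\<close> P(3) by (auto simp: D_def i)
    moreover have determ: "snd j x = snd j y"
      if "j \<in> D" "x \<in> univ F" "y \<in> univ F" "snd i x = snd i y" for j x y
      using that ker[of "fst j" "snd j" x y] by (auto simp: D_def I_def i)
    moreover have "(snd j x, snd j y) \<in> R j"
      if j: "j \<in> D" and xy: "x \<in> univ F" "y \<in> univ F" and R: "(snd i x, snd i y) \<in> R i" for j x y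
    proof -
      have "snd i (term_fun F s [x, y]) = snd i (term_fun F t [x, y])"
        using R R_iff[OF h xy] by (simp add: i)
      then have "snd j (term_fun F s [x, y]) = snd j (term_fun F t [x, y])"
        using determ[OF j] closed2 s t xy by blast
      then show ?thesis
        using j R_iff[OF _ xy, of "fst j" "snd j"] by (auto simp: D_def I_def)
    qed
    ultimately show "\<exists>D. i \<in> D \<and> D \<subseteq> I \<and>
      (\<forall>u\<in>univ F. \<forall>v\<in>univ F. \<exists>w\<in>univ F. \<forall>j\<in>I. snd j w = (if j \<in> D then snd j u else snd j v)) \<and>
      (\<forall>j\<in>D. \<forall>x\<in>univ F. \<forall>y\<in>univ F. snd i x = snd i y \<longrightarrow> snd j x = snd j y) \<and>
      (\<forall>j\<in>D. \<forall>x\<in>univ F. \<forall>y\<in>univ F. (snd i x, snd i y) \<in> R i \<longrightarrow> (snd j x, snd j y) \<in> R j)"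
      by (intro exI[of _ D]) blast
  qed (use assms(6) sep in auto)
qed

end
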